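(* Let $f:\mathbb{R}^d\to\mathbb{R}$ be convex and $G$-Lipschitz continuous (not necessarily differentiable), let $h:\mathbb{R}^d\to\mathbb{R}\cup\{+\infty\}$ be convex, proper and lower semicontinuous, and suppose $F=f+h$ attains its minimum $F^*=F(x^* )$ at some $x^*\in\mathbb{R}^d$. Let $\{x_k,y_k,z_k\}_{k\ge1}$ be the iterates generated by the full-gradient adaptive accelerated proximal gradient method described in the context, with $y_1=z_1\in\mathrm{dom}(h)$ and parameters $\gamma>0$ and $\eta>\sqrt2D/2$, where $D>0$ is a constant such that $\|z_{k+1}-z_k\|\le D$ and $\|z_k-x^*\|\le D$ for all $k\ge1$. Then there is a constant $c>0$ depending only on $G,\gamma,\eta,D$ and $F(y_1)-F^*$ such that for every $t\ge2$, $$F(y_{t+1})-F^*\le c\,\frac{\sqrt{\log t}}{\sqrt t}.$$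
   Context: $\|\cdot\|$ is the Euclidean norm and $\log$ the natural logarithm. $f$ is $G$-Lipschitz continuous if $|f(y)-f(x)|\le G\|y-x\|$ for all $x,y$. $\nabla f(x)\in\partial f(x)$ denotes a subgradient of $f$ at $x$ when $f$ is not differentiable. $\mathrm{dom}(h):=\{x:h(x)<+\infty\}$. Full-gradient adaptive accelerated proximal gradient method: set $S_1:=\gamma$, $\alpha_0:=0$. For $k=1,2,\dots$: $\alpha_k:=\frac{1+\sqrt{1+4\alpha_{k-1}^2}}{2}$, $\theta_k:=1/\alpha_k$, $x_k:=(1-\theta_k)y_k+\theta_kz_k$, $g_k:=\nabla f(x_k)$; $$z_{k+1}:=\operatorname*{arg\,min}_{x\in\mathbb{R}^d}\Big\{\langle g_k,x\rangle+\frac{\theta_kS_k}{2\eta}\|x-z_k\|^2+h(x)\Big\},\qquad y_{k+1}:=x_k+\theta_k(z_{k+1}-z_k),$$ $$S_{k+1}^2:=S_k^2\Big(1+\frac{\|z_{k+1}-z_k\|^2}{\eta^2}\Big),\quad S_{k+1}>0.$$ *)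

theory Defs
  imports "HOL-Analysis.Analysis"
begin

text \<open>
  The constant in the convergence rate must not depend on the dimension \<open>d\<close>, so \<open>d\<close> has to be
  quantified inside the statement and cannot be carried by a type such as \<^typ>\<open>real ^ 'n\<close>.
  All spaces \<open>\<real>\<^sup>d\<close> are therefore realised inside one real inner product space, the finitely
  supported real sequences, as the subspaces \<open>Rd d\<close> of sequences vanishing from index \<open>d\<close> on.
  (The library type of finitely supported functions carries the \<open>\<ell>\<^sup>1\<close> norm, hence a new type.)
\<close>

typedef fseq = "{x :: nat \<Rightarrow> real. finite {i. x i \<noteq> 0}}"
  morphisms coord Abs_fseq
  by (intro exI[of _ "\<lambda>_. 0"]) simp

setup_lifting type_definition_fseq

lemma finite_coord [simp]: "finite {i. coord x i \<noteq> 0}"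
  using coord[of x] by simp

lemma fseq_eqI: "(\<And>i. coord x i = coord y i) \<Longrightarrow> x = y"
  by (auto simp flip: coord_inject)

instantiation fseq :: real_vector
begin

lift_definition zero_fseq :: fseq is "\<lambda>_. 0" by simp

lift_definition plus_fseq :: "fseq \<Rightarrow> fseq \<Rightarrow> fseq" is "\<lambda>x y i. x i + y i"
proof -
  fix x y :: "nat \<Rightarrow> real"
  assume "finite {i. x i \<noteq> 0}" "finite {i. y i \<noteq> 0}"
  then show "finite {i. x i + y i \<noteq> 0}"
    by (auto intro: finite_subset[of _ "{i. x i \<noteq> 0} \<union> {i. y i \<noteq> 0}"])
qed

lift_definition minus_fseq :: "fseq \<Rightarrow> fseq \<Rightarrow> fseq" is "\<lambda>x y i. x i - y i"
proof -
  fix x y :: "nat \<Rightarrow> real"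
  assume "finite {i. x i \<noteq> 0}" "finite {i. y i \<noteq> 0}"
  then show "finite {i. x i - y i \<noteq> 0}"
    by (auto intro: finite_subset[of _ "{i. x i \<noteq> 0} \<union> {i. y i \<noteq> 0}"])
qed

lift_definition uminus_fseq :: "fseq \<Rightarrow> fseq" is "\<lambda>x i. - x i" by simp

lift_definition scaleR_fseq :: "real \<Rightarrow> fseq \<Rightarrow> fseq" is "\<lambda>r x i. r * x i"
  by (auto intro: rev_finite_subset)

instance
  by standard (transfer; simp add: algebra_simps; fail)+

end

lemma coord_simps [simp]:
  "coord 0 i = 0"
  "coord (x + y) i = coord x i + coord y i"
  "coord (x - y) i = coord x i - coord y i"
  "coord (- x) i = - coord x i"
  "coord (r *\<^sub>R x) i = r * coord x i"
  by (transfer; simp)+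

instantiation fseq :: real_inner
begin

definition inner_fseq :: "fseq \<Rightarrow> fseq \<Rightarrow> real" where
  "inner_fseq x y = (\<Sum>i | coord x i \<noteq> 0. coord x i * coord y i)"

definition norm_fseq :: "fseq \<Rightarrow> real" where
  "norm_fseq x = sqrt (inner x x)"

definition sgn_fseq :: "fseq \<Rightarrow> fseq" where
  "sgn_fseq x = x /\<^sub>R norm x"

definition dist_fseq :: "fseq \<Rightarrow> fseq \<Rightarrow> real" where
  "dist_fseq x y = norm (x - y)"

definition uniformity_fseq :: "(fseq \<times> fseq) filter" where
  "uniformity_fseq = (INF e\<in>{0<..}. principal {(x, y). dist x y < e})"

definition open_fseq :: "fseq set \<Rightarrow> bool" where
  "open_fseq U \<longleftrightarrow> (\<forall>x\<in>U. \<forall>\<^sub>F (x', y) in uniformity. x' = x \<longrightarrow> y \<in> U)"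

lemma inner_fseq_superset:
  assumes "finite A" "{i. coord x i \<noteq> 0} \<subseteq> A"
  shows "inner x y = (\<Sum>i\<in>A. coord x i * coord y i)"
  unfolding inner_fseq_def using assms by (intro sum.mono_neutral_left) auto

instance
proof
  fix x y z :: fseq and r :: real
  let ?A = "{i. coord x i \<noteq> 0} \<union> {i. coord y i \<noteq> 0}"
  show "dist x y = norm (x - y)" by (fact dist_fseq_def)
  show "sgn x = x /\<^sub>R norm x" by (fact sgn_fseq_def)
  show "uniformity = (INF e\<in>{0<..}. principal {(x :: fseq, y). dist x y < e})"
    by (fact uniformity_fseq_def)
  show "open U \<longleftrightarrow> (\<forall>x\<in>U. \<forall>\<^sub>F (x', y) in uniformity. x' = x \<longrightarrow> y \<in> U)" for U :: "fseq set"
    by (fact open_fseq_def)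
  show "norm x = sqrt (inner x x)" by (fact norm_fseq_def)
  have "inner x y = (\<Sum>i\<in>?A. coord x i * coord y i)"
    "inner y x = (\<Sum>i\<in>?A. coord y i * coord x i)"
    by (auto intro: inner_fseq_superset)
  then show "inner x y = inner y x" by (simp add: mult.commute)
  have "inner (x + y) z = (\<Sum>i\<in>?A. coord (x + y) i * coord z i)"
    "inner x z = (\<Sum>i\<in>?A. coord x i * coord z i)"
    "inner y z = (\<Sum>i\<in>?A. coord y i * coord z i)"
    by (rule inner_fseq_superset; auto)+
  then show "inner (x + y) z = inner x z + inner y z"
    by (simp add: sum.distrib algebra_simps)
  have "inner (r *\<^sub>R x) y = (\<Sum>i | coord x i \<noteq> 0. coord (r *\<^sub>R x) i * coord y i)"
    by (rule inner_fseq_superset) auto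
  then show "inner (r *\<^sub>R x) y = r * inner x y"
    by (simp add: inner_fseq_def sum_distrib_left mult.assoc)
  show "0 \<le> inner x x"
    unfolding inner_fseq_def by (intro sum_nonneg) auto
  have "inner x x = 0 \<longleftrightarrow> (\<forall>i\<in>{i. coord x i \<noteq> 0}. coord x i * coord x i = 0)"
    unfolding inner_fseq_def by (intro sum_nonneg_eq_0_iff) auto
  also have "\<dots> \<longleftrightarrow> x = 0"
    by (auto intro: fseq_eqI)
  finally show "inner x x = 0 \<longleftrightarrow> x = 0" .
qed

end

definition Rd :: "nat \<Rightarrow> fseq set" where
  "Rd d = {x. \<forall>i\<ge>d. coord x i = 0}"

text \<open>The next four facts confirm that \<open>Rd d\<close> is Euclidean \<open>d\<close>-space.\<close>

lemma subspace_Rd: "subspace (Rd d)"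
  by (auto simp: subspace_def Rd_def)

lemma bij_betw_coord_Rd:
  "bij_betw (\<lambda>x. restrict (coord x) {..<d}) (Rd d) ({..<d} \<rightarrow>\<^sub>E UNIV)"
  unfolding bij_betw_def
proof (intro conjI inj_onI equalityI subsetI)
  fix x y
  assume x: "x \<in> Rd d" and y: "y \<in> Rd d"
    and eq: "restrict (coord x) {..<d} = restrict (coord y) {..<d}"
  show "x = y"
  proof (rule fseq_eqI)
    fix i
    show "coord x i = coord y i"
      using x y fun_cong[OF eq, of i] by (cases "i < d") (simp_all add: Rd_def)
  qed
next
  fix v
  assume "v \<in> (\<lambda>x. restrict (coord x) {..<d}) ` Rd d"
  then obtain x where "v = restrict (coord x) {..<d}"
    by (elim imageE)
  then show "v \<in> {..<d} \<rightarrow>\<^sub>E UNIV"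
    by (simp add: PiE_def)
next
  fix v :: "nat \<Rightarrow> real"
  assume v: "v \<in> {..<d} \<rightarrow>\<^sub>E UNIV"
  define w where "w = (\<lambda>i. if i < d then v i else 0)"
  have "{i. w i \<noteq> 0} \<subseteq> {..<d}"
    by (rule subsetI) (simp add: w_def split: if_splits)
  then have "finite {i. w i \<noteq> 0}"
    by (rule finite_subset) simp
  then have w: "coord (Abs_fseq w) = w"
    by (intro Abs_fseq_inverse CollectI)
  show "v \<in> (\<lambda>x. restrict (coord x) {..<d}) ` Rd d"
  proof (rule image_eqI)
    show "Abs_fseq w \<in> Rd d"
      unfolding Rd_def mem_Collect_eq w by (simp add: w_def)
    show "v = restrict (coord (Abs_fseq w)) {..<d}"
    proof (rule ext)
      fix i
      show "v i = restrict (coord (Abs_fseq w)) {..<d} i"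
        unfolding w using PiE_arb[OF v, of i] by (cases "i < d") (simp_all add: w_def)
    qed
  qed
qed

lemma inner_Rd:
  assumes "x \<in> Rd d"
  shows "inner x y = (\<Sum>i<d. coord x i * coord y i)"
proof (rule inner_fseq_superset)
  show "{i. coord x i \<noteq> 0} \<subseteq> {..<d}"
    using assms leI unfolding Rd_def by blast
qed simp

lemma norm_Rd:
  assumes "x \<in> Rd d"
  shows "norm x = L2_set (coord x) {..<d}"
  unfolding norm_fseq_def inner_Rd[OF assms] L2_set_def power2_eq_square ..

definition subdifferential :: "'a::real_inner set \<Rightarrow> ('a \<Rightarrow> real) \<Rightarrow> 'a \<Rightarrow> 'a set" where
  "subdifferential V f x = {g \<in> V. \<forall>y\<in>V. f y \<ge> f x + inner g (y - x)}"

definition dom_on :: "'a set \<Rightarrow> ('a \<Rightarrow> ereal) \<Rightarrow> 'a set" where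
  "dom_on V h = {x \<in> V. h x < \<infinity>}"

definition proper_on :: "'a set \<Rightarrow> ('a \<Rightarrow> ereal) \<Rightarrow> bool" where
  "proper_on V h \<longleftrightarrow> (\<forall>x\<in>V. h x \<noteq> -\<infinity>) \<and> dom_on V h \<noteq> {}"

text \<open>Only used for functions that never take the value \<open>-\<infinity>\<close>; recall \<open>0 * \<infinity> = 0\<close> in \<^typ>\<open>ereal\<close>.\<close>

definition ereal_convex_on :: "'a::real_vector set \<Rightarrow> ('a \<Rightarrow> ereal) \<Rightarrow> bool" where
  "ereal_convex_on V h \<longleftrightarrow> convex V \<and>
     (\<forall>x\<in>V. \<forall>y\<in>V. \<forall>u\<ge>0. \<forall>v\<ge>0. u + v = 1 \<longrightarrow>
        h (u *\<^sub>R x + v *\<^sub>R y) \<le> ereal u * h x + ereal v * h y)"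

definition lsc_on :: "'a::topological_space set \<Rightarrow> ('a \<Rightarrow> ereal) \<Rightarrow> bool" where
  "lsc_on V h \<longleftrightarrow> (\<forall>x\<in>V. h x \<le> Liminf (at x within V) h)"

definition objective :: "('a \<Rightarrow> real) \<Rightarrow> ('a \<Rightarrow> ereal) \<Rightarrow> 'a \<Rightarrow> ereal" where
  "objective f h x = ereal (f x) + h x"

primrec alpha :: "nat \<Rightarrow> real" where
  "alpha 0 = 0"
| "alpha (Suc k) = (1 + sqrt (1 + 4 * (alpha k)\<^sup>2)) / 2"

definition theta :: "nat \<Rightarrow> real" where
  "theta k = 1 / alpha k"

text \<open>
  The iterates of the method on \<open>\<real>\<^sup>d\<close>, with arbitrary starting points \<open>y 1\<close> and \<open>z 1\<close>.  Index \<open>0\<close>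
  of the sequences is unused.  Any subgradient may be chosen at each step.  The prox
  subproblem is strongly convex, so \<open>is_arg_min\<close> determines \<open>z (Suc k)\<close> uniquely.
\<close>

definition adaptive_apg ::
  "nat \<Rightarrow> (fseq \<Rightarrow> real) \<Rightarrow> (fseq \<Rightarrow> ereal) \<Rightarrow> real \<Rightarrow> real \<Rightarrow>
   (nat \<Rightarrow> fseq) \<Rightarrow> (nat \<Rightarrow> fseq) \<Rightarrow> (nat \<Rightarrow> fseq) \<Rightarrow> (nat \<Rightarrow> fseq) \<Rightarrow> (nat \<Rightarrow> real) \<Rightarrow> bool"
where
  "adaptive_apg d f h \<gamma> \<eta> x y z g S \<longleftrightarrow>
     S 1 = \<gamma> \<and>
     (\<forall>k\<ge>1.
        x k = (1 - theta k) *\<^sub>R y k + theta k *\<^sub>R z k \<and>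
        g k \<in> subdifferential (Rd d) f (x k) \<and>
        is_arg_min
          (\<lambda>u. ereal (inner (g k) u + theta k * S k / (2 * \<eta>) * (norm (u - z k))\<^sup>2) + h u)
          (\<lambda>u. u \<in> Rd d) (z (Suc k)) \<and>
        y (Suc k) = x k + theta k *\<^sub>R (z (Suc k) - z k) \<and>
        (S (Suc k))\<^sup>2 = (S k)\<^sup>2 * (1 + (norm (z (Suc k) - z k))\<^sup>2 / \<eta>\<^sup>2) \<and>
        S (Suc k) > 0)"

end

theory Submission
  imports Defs
begin

text \<open>
  Write \<open>E k = F (y k) - F x*\<close>, \<open>R k = \<parallel>z k - x*\<parallel>\<close> and \<open>d k = \<parallel>z (k + 1) - z k\<parallel>\<close>.  Lipschitz continuity and
  the three-point inequality of the prox step give, since \<open>\<alpha>\<^sub>k\<^sup>2 (1 - \<theta>\<^sub>k) = \<alpha>\<^sub>k\<^sub>-\<^sub>1\<^sup>2\<close>,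
  \<open>\<alpha>\<^sub>k\<^sup>2 E (k + 1) \<le> \<alpha>\<^sub>k\<^sub>-\<^sub>1\<^sup>2 E k + S k / (2 \<eta>) (R k\<^sup>2 - R (k + 1)\<^sup>2 - d k\<^sup>2) + 2 G \<alpha>\<^sub>k d k\<close>.
  The update rule of \<open>S\<close> gives \<open>S k d k\<^sup>2 / (2 \<eta>) \<ge> \<eta> (S (k + 1) - S k)\<close>, so after summation the
  quadratic terms are at most \<open>\<eta> \<gamma> - (\<eta> - D\<^sup>2 / (2 \<eta>)) S (t + 1)\<close>, with a positive coefficient because
  \<open>D\<^sup>2 < 2 \<eta>\<^sup>2\<close>.  By Cauchy-Schwarz the error term is
  \<open>O (sqrt (t\<^sup>3 ln (S (t + 1) / \<gamma>)))\<close>.  If \<open>S (t + 1)\<close> is polynomial in \<open>t\<close> this is \<open>O (sqrt (t\<^sup>3 ln t))\<close>,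
  and otherwise the negative multiple of \<open>S (t + 1)\<close> absorbs it.  Now divide by \<open>\<alpha>\<^sub>t\<^sup>2 \<ge> t\<^sup>2 / 4\<close>.
\<close>

section \<open>The step-size sequence \<open>alpha\<close>\<close>

text \<open>\<open>alpha (Suc k)\<close> is the positive root of a quadratic chosen so that
  weighting the gap recursion by \<open>(alpha k)\<^sup>2\<close> makes it telescope.\<close>

lemma alpha_Suc_eq: "(alpha (Suc k))\<^sup>2 - alpha (Suc k) = (alpha k)\<^sup>2"
proof -
  have "(sqrt (1 + 4 * (alpha k)\<^sup>2))\<^sup>2 = 1 + 4 * (alpha k)\<^sup>2"
    by (rule real_sqrt_pow2) (simp add: add_nonneg_nonneg)
  then show ?thesis
    by (simp add: power_divide power2_sum field_simps)
qed

lemma alpha_Suc_ge: "alpha k + 1 / 2 \<le> alpha (Suc k)"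
proof -
  have "2 * alpha k \<le> sqrt (1 + 4 * (alpha k)\<^sup>2)"
    by (rule real_le_rsqrt) (simp add: power_mult_distrib)
  then show ?thesis by simp
qed

lemma alpha_nonneg: "0 \<le> alpha k"
proof (induction k)
  case (Suc k)
  then show ?case using alpha_Suc_ge[of k] by linarith
qed simp

text \<open>Each step adds at least 1/2, starting from \<open>alpha 1 = 1\<close>. This quadratic
  growth of the squared weight is what the final division uses.\<close>

lemma alpha_Suc_lower: "real k / 2 + 1 \<le> alpha (Suc k)"
proof (induction k)
  case (Suc k)
  then show ?case using alpha_Suc_ge[of "Suc k"] by (simp add: field_simps del: alpha.simps)
qed simp

lemma alpha_upper: "alpha k \<le> real k"
proof (induction k)
  case (Suc k)
  have "sqrt (1 + 4 * (alpha k)\<^sup>2) \<le> 1 + 2 * alpha k"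
    by (rule real_le_lsqrt) (use alpha_nonneg[of k] in \<open>auto simp: power2_sum power_mult_distrib\<close>)
  then show ?case using Suc by simp
qed simp

section \<open>One step of the method\<close>

text \<open>Testing minimality of \<open>p\<close> along the segment towards \<open>w\<close> and
  shrinking the step to 0 gives a first-order optimality condition. Polarisation then turns its
  inner product into squared distances.\<close>

lemma prox_three_point:
  fixes H :: "'a::real_inner \<Rightarrow> real"
  assumes H: "convex_on C H" and p: "p \<in> C" and w: "w \<in> C"
    and min: "\<And>u. u \<in> C \<Longrightarrow>
      inner g p + a * (norm (p - z))\<^sup>2 + H p \<le> inner g u + a * (norm (u - z))\<^sup>2 + H u"
  shows "inner g p + H p + a * (norm (p - z))\<^sup>2
    \<le> inner g w + H w + a * ((norm (z - w))\<^sup>2 - (norm (p - w))\<^sup>2)"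
proof -
  \<comment> \<open>Moving a fraction \<open>l\<close> from \<open>p\<close> to \<open>w\<close>
    raises the objective by at most \<open>l * (e + l * b)\<close>: \<open>e\<close> bounds the
    slope, \<open>b\<close> is the second-order part of the quadratic.\<close>
  define e where "e = H w - H p + inner g (w - p) + 2 * a * inner (p - z) (w - p)"
  define b where "b = a * (norm (w - p))\<^sup>2"
  have e_ge: "0 \<le> e + l * b" if l: "0 < l" "l < 1" for l
  proof -
    define u where "u = (1 - l) *\<^sub>R p + l *\<^sub>R w"
    have u: "u = p + l *\<^sub>R (w - p)"
      by (simp add: u_def algebra_simps)
    have "u \<in> C"
      unfolding u_def using convexD[OF convex_on_imp_convex[OF H] p w, of "1 - l" l] l by simp
    moreover have "H u \<le> (1 - l) * H p + l * H w"
      unfolding u_def using convex_onD[OF H, of l p w] l p w by simp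
    moreover have "(norm (u - z))\<^sup>2
        = (norm (p - z))\<^sup>2 + 2 * l * inner (p - z) (w - p) + l\<^sup>2 * (norm (w - p))\<^sup>2"
      unfolding u power2_norm_eq_inner
      by (simp add: inner_simps inner_commute algebra_simps power2_eq_square)
    moreover have "inner g u = inner g p + l * inner g (w - p)"
      unfolding u by (simp add: inner_simps)
    ultimately have "inner g p + a * (norm (p - z))\<^sup>2 + H p
        \<le> inner g p + l * inner g (w - p)
          + a * ((norm (p - z))\<^sup>2 + 2 * l * inner (p - z) (w - p) + l\<^sup>2 * (norm (w - p))\<^sup>2)
          + ((1 - l) * H p + l * H w)"
      using min[of u] by simp
    also have "\<dots> = inner g p + a * (norm (p - z))\<^sup>2 + H p + l * (e + l * b)"
      unfolding e_def b_def power2_eq_square by (simp only: algebra_simps mult_1_left mult_1_right)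
    finally have "0 \<le> l * (e + l * b)" by simp
    then show ?thesis using l by (simp add: zero_le_mult_iff)
  qed
  have "0 \<le> e"
  proof (rule tendsto_lowerbound)
    show "((\<lambda>l. e + l * b) \<longlongrightarrow> e) (at_right 0)"
      by (auto intro!: tendsto_eq_intros)
    show "\<forall>\<^sub>F l in at_right 0. 0 \<le> e + l * b"
      using eventually_at_right_real[of 0 1] by (rule eventually_mono) (auto intro: e_ge)
  qed simp
  moreover have "2 * inner (p - z) (w - p)
      = (norm (z - w))\<^sup>2 - (norm (p - z))\<^sup>2 - (norm (p - w))\<^sup>2"
    unfolding power2_norm_eq_inner by (simp add: inner_simps inner_commute algebra_simps)
  then have "2 * a * inner (p - z) (w - p)
      = a * ((norm (z - w))\<^sup>2 - (norm (p - z))\<^sup>2 - (norm (p - w))\<^sup>2)"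
    by (metis mult.assoc mult.commute)
  ultimately show ?thesis
    unfolding e_def by (simp add: inner_diff_right right_diff_distrib)
qed

text \<open>The subgradient inequality is tested at \<open>x + g\<close>, which stays in
  \<open>V\<close> because \<open>subdifferential\<close> only admits \<open>g\<close> in
  \<open>V\<close>.\<close>

lemma norm_subgradient_le:
  fixes f :: "'a::real_inner \<Rightarrow> real"
  assumes V: "subspace V" and f: "L-lipschitz_on V f" and x: "x \<in> V"
    and g: "g \<in> subdifferential V f x"
  shows "norm g \<le> L"
proof (cases "g = 0")
  case True
  then show ?thesis using lipschitz_on_nonneg[OF f] by simp
next
  case False
  have gV: "g \<in> V" and sub: "\<And>y. y \<in> V \<Longrightarrow> f x + inner g (y - x) \<le> f y"
    using g by (auto simp: subdifferential_def)
  have xg: "x + g \<in> V" using V x gV by (rule subspace_add)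
  have "norm g * norm g \<le> f (x + g) - f x"
    using sub[OF xg] by (simp add: norm_eq_sqrt_inner)
  also have "\<dots> \<le> L * norm g"
    using lipschitz_onD[OF f xg x] by (simp add: dist_norm)
  finally show ?thesis using False by simp
qed

text \<open>The new point is \<open>(1 - \<theta>) *\<^sub>R y + \<theta> *\<^sub>R p\<close>, so
  convexity of \<open>H\<close> applies to it directly. The error
  \<open>2 * L * \<theta> * norm (p - z)\<close> has two equal halves: the Lipschitz cost of moving
  from \<open>x\<close> to \<open>y'\<close>, and the bound on
  \<open>inner g (p - z)\<close>.\<close>

lemma apg_step:
  fixes f H :: "'a::real_inner \<Rightarrow> real"
  assumes V: "subspace V" and f: "L-lipschitz_on V f"
    and H: "convex_on C H" and CV: "C \<subseteq> V"
    and th: "0 < \<theta>" "\<theta> \<le> 1"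
    and y: "y \<in> C" and z: "z \<in> C" and p: "p \<in> C" and w: "w \<in> C"
    and x_eq: "x = (1 - \<theta>) *\<^sub>R y + \<theta> *\<^sub>R z"
    and g: "g \<in> subdifferential V f x"
    and min: "\<And>u. u \<in> C \<Longrightarrow>
      inner g p + a * (norm (p - z))\<^sup>2 + H p \<le> inner g u + a * (norm (u - z))\<^sup>2 + H u"
    and y'_eq: "y' = x + \<theta> *\<^sub>R (p - z)"
  shows "y' \<in> C"
    and "f y' + H y' - (f w + H w) \<le> (1 - \<theta>) * (f y + H y - (f w + H w))
      + \<theta> * a * ((norm (z - w))\<^sup>2 - (norm (p - w))\<^sup>2 - (norm (p - z))\<^sup>2)
      + 2 * L * \<theta> * norm (p - z)"
proof -
  have y': "y' = (1 - \<theta>) *\<^sub>R y + \<theta> *\<^sub>R p"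
    by (simp add: y'_eq x_eq algebra_simps)
  note C = convexD[OF convex_on_imp_convex[OF H]]
  show "y' \<in> C"
    unfolding y' using C[OF y p, of "1 - \<theta>" \<theta>] th by simp
  have "x \<in> C"
    unfolding x_eq using C[OF y z, of "1 - \<theta>" \<theta>] th by simp
  then have x: "x \<in> V" using CV by blast
  have V': "y' \<in> V" "y \<in> V" "w \<in> V" using \<open>y' \<in> C\<close> y w CV by auto
  have sub: "\<And>u. u \<in> V \<Longrightarrow> f x + inner g (u - x) \<le> f u"
    using g by (auto simp: subdifferential_def)
  have Hy': "H y' \<le> (1 - \<theta>) * H y + \<theta> * H p"
    unfolding y' using convex_onD[OF H, of \<theta> y p] th y p by simp
  have nd: "norm (y' - x) = \<theta> * norm (p - z)"
    using th by (simp add: y'_eq)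
  have "f y' - f x \<le> L * norm (y' - x)"
    using lipschitz_onD[OF f V'(1) x] by (simp add: dist_norm)
  then have fy': "f y' \<le> f x + L * (\<theta> * norm (p - z))"
    by (simp add: nd)
  have "- inner g (p - z) \<le> norm g * norm (p - z)"
    using Cauchy_Schwarz_ineq2[of g "p - z"] by linarith
  also have "\<dots> \<le> L * norm (p - z)"
    by (intro mult_right_mono norm_subgradient_le[OF V f x g]) simp
  finally have gd: "\<theta> * (- inner g (p - z)) \<le> \<theta> * (L * norm (p - z))"
    using th by (intro mult_left_mono) auto
  have pr: "\<theta> * (inner g p + H p + a * (norm (p - z))\<^sup>2)
      \<le> \<theta> * (inner g w + H w + a * ((norm (z - w))\<^sup>2 - (norm (p - w))\<^sup>2))"
    using th by (intro mult_left_mono prox_three_point[OF H p w min]) auto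
  have s1: "(1 - \<theta>) * (f x + inner g (y - x)) \<le> (1 - \<theta>) * f y"
    using th sub V' by (intro mult_left_mono) auto
  have s2: "\<theta> * (f x + inner g (w - x)) \<le> \<theta> * f w"
    using th sub V' by (intro mult_left_mono) auto
  \<comment> \<open>Since \<open>x\<close> averages \<open>y\<close> and \<open>z\<close>, the
    weighted sum of \<open>s1\<close> and \<open>s2\<close> leaves only
    \<open>\<theta> * inner g (w - z)\<close>. Together with \<open>pr\<close> this becomes the
    inner product bounded in \<open>gd\<close>.\<close>
  have s3: "(1 - \<theta>) * inner g (y - x) + \<theta> * inner g (z - x) = 0"
    by (simp add: x_eq inner_simps algebra_simps)
  show "f y' + H y' - (f w + H w) \<le> (1 - \<theta>) * (f y + H y - (f w + H w))
      + \<theta> * a * ((norm (z - w))\<^sup>2 - (norm (p - w))\<^sup>2 - (norm (p - z))\<^sup>2)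
      + 2 * L * \<theta> * norm (p - z)"
    using Hy' fy' gd pr s1 s2 s3 by (simp add: inner_simps algebra_simps)
qed

section \<open>Summation over the iterations\<close>

text \<open>Keeping the term in \<open>R (Suc t)\<close> on the left makes the induction an Abel
  summation with the increasing weights \<open>S\<close>.\<close>

lemma telescoped_bound:
  fixes E S R d :: "nat \<Rightarrow> real"
  assumes eta: "0 < \<eta>" and Spos: "\<And>k. 1 \<le> k \<Longrightarrow> 0 < S k"
    and Srec: "\<And>k. 1 \<le> k \<Longrightarrow> (S (Suc k))\<^sup>2 = (S k)\<^sup>2 * (1 + (d k)\<^sup>2 / \<eta>\<^sup>2)"
    and R: "\<And>k. 1 \<le> k \<Longrightarrow> 0 \<le> R k \<and> R k \<le> D"
    and step: "\<And>k. 1 \<le> k \<Longrightarrow> E (Suc k) \<le> (1 - theta k) * E k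
      + theta k * (theta k * S k / (2 * \<eta>)) * ((R k)\<^sup>2 - (R (Suc k))\<^sup>2 - (d k)\<^sup>2)
      + 2 * L * theta k * d k"
  shows "(alpha t)\<^sup>2 * E (Suc t) + S (Suc t) / (2 * \<eta>) * (R (Suc t))\<^sup>2
    \<le> D\<^sup>2 * S (Suc t) / (2 * \<eta>) - \<eta> * (S (Suc t) - S 1) + 2 * L * (\<Sum>k=1..t. alpha k * d k)"
proof (induction t)
  \<comment> \<open>\<open>alpha 0 = 0\<close> removes \<open>E 1\<close>; only
    \<open>R 1 \<le> D\<close> remains to be used.\<close>
  case 0
  have "(R 1)\<^sup>2 \<le> D\<^sup>2" using R[of 1] by (intro power_mono) auto
  then have "S 1 / (2 * \<eta>) * (R 1)\<^sup>2 \<le> S 1 / (2 * \<eta>) * D\<^sup>2"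
    using Spos[of 1] eta by (intro mult_left_mono) auto
  then show ?case by (simp add: mult.commute)
next
  case (Suc t)
  define k where "k = Suc t"
  have k: "1 \<le> k" by (simp add: k_def)
  have apos: "0 < alpha k"
    unfolding k_def using alpha_Suc_lower[of t] by linarith
  have S: "0 < S k" "0 < S (Suc k)" using Spos k by auto
  have a1: "(alpha k)\<^sup>2 * (1 - theta k) = (alpha t)\<^sup>2"
    using alpha_Suc_eq[of t] apos by (simp add: theta_def k_def power2_eq_square field_simps)
  have "(alpha k)\<^sup>2 * E (Suc k) \<le> (alpha k)\<^sup>2 * ((1 - theta k) * E k
      + theta k * (theta k * S k / (2 * \<eta>)) * ((R k)\<^sup>2 - (R (Suc k))\<^sup>2 - (d k)\<^sup>2)
      + 2 * L * theta k * d k)"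
    by (intro mult_left_mono step k) simp
  also have "\<dots> = (alpha k)\<^sup>2 * (1 - theta k) * E k
      + (alpha k * theta k)\<^sup>2 * (S k / (2 * \<eta>) * ((R k)\<^sup>2 - (R (Suc k))\<^sup>2 - (d k)\<^sup>2))
      + 2 * L * (alpha k * theta k) * (alpha k * d k)"
    by (simp add: algebra_simps power2_eq_square flip: add_divide_distrib)
  also have "alpha k * theta k = 1"
    using apos by (simp add: theta_def)
  finally have main: "(alpha k)\<^sup>2 * E (Suc k) \<le> (alpha t)\<^sup>2 * E k
      + S k / (2 * \<eta>) * ((R k)\<^sup>2 - (R (Suc k))\<^sup>2 - (d k)\<^sup>2) + 2 * L * (alpha k * d k)"
    by (simp add: a1)
  have Sd: "(S (Suc k))\<^sup>2 - (S k)\<^sup>2 = (S k)\<^sup>2 * (d k)\<^sup>2 / \<eta>\<^sup>2"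
    using Srec[OF k] by (simp add: algebra_simps)
  have "0 \<le> (S (Suc k))\<^sup>2 - (S k)\<^sup>2" unfolding Sd by simp
  then have mono: "S k \<le> S (Suc k)"
    using S by (simp add: power2_le_iff_abs_le)
  \<comment> \<open>The tangent inequality for the square passes from the recursion for squares to
    the increment of \<open>S\<close> itself, so the negative term in \<open>d k\<close> can be
    replaced by a telescoping one.\<close>
  have "2 * S k * (S (Suc k) - S k) \<le> (S (Suc k))\<^sup>2 - (S k)\<^sup>2"
    using zero_le_power2[of "S (Suc k) - S k"] by (simp add: power2_eq_square algebra_simps)
  also have "\<dots> = S k * (S k * (d k)\<^sup>2 / \<eta>\<^sup>2)"
    unfolding Sd by (simp add: power2_eq_square)
  finally have "2 * (S (Suc k) - S k) \<le> S k * (d k)\<^sup>2 / \<eta>\<^sup>2"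
    using S(1) mult_le_cancel_left_pos[OF S(1), of "2 * (S (Suc k) - S k)"]
    by (simp only: mult.left_commute[of _ "S k"] mult.assoc)
  then have grow: "\<eta> * (S (Suc k) - S k) \<le> S k / (2 * \<eta>) * (d k)\<^sup>2"
    using eta by (simp add: field_simps power2_eq_square)
  \<comment> \<open>Raising the weight of the retained \<open>R\<close> term from \<open>S k\<close>
    to \<open>S (Suc k)\<close> costs at most the increment times \<open>D\<^sup>2\<close>, as the
    increment is nonnegative.\<close>
  have "(R (Suc k))\<^sup>2 \<le> D\<^sup>2" using R[of "Suc k"] by (intro power_mono) auto
  then have abel: "(S (Suc k) - S k) / (2 * \<eta>) * (R (Suc k))\<^sup>2 \<le> (S (Suc k) - S k) / (2 * \<eta>) * D\<^sup>2"
    using mono eta by (intro mult_left_mono) auto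
  have IH: "(alpha t)\<^sup>2 * E k + S k / (2 * \<eta>) * (R k)\<^sup>2
    \<le> D\<^sup>2 * S k / (2 * \<eta>) - \<eta> * (S k - S 1) + 2 * L * (\<Sum>k=1..t. alpha k * d k)"
    using Suc.IH by (simp add: k_def)
  have sum: "(\<Sum>j=1..k. alpha j * d j) = (\<Sum>j=1..t. alpha j * d j) + alpha k * d k"
    by (simp add: k_def del: alpha.simps)
  show ?case
    unfolding k_def[symmetric] sum
    using main grow abel IH by (simp add: algebra_simps diff_divide_distrib)
qed

text \<open>With \<open>u = (d k)\<^sup>2 / \<eta>\<^sup>2 \<le> 2\<close> one has
  \<open>u / 3 \<le> u / (1 + u) \<le> ln (1 + u)\<close>, and \<open>1 + u\<close> is the squared
  ratio of consecutive \<open>S\<close>. The logarithms telescope, and 6 is 3 times the exponent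
  2.\<close>

lemma sum_displacement_sq_le:
  fixes S d :: "nat \<Rightarrow> real"
  assumes eta: "0 < \<eta>" and Spos: "\<And>k. 1 \<le> k \<Longrightarrow> 0 < S k"
    and Srec: "\<And>k. 1 \<le> k \<Longrightarrow> (S (Suc k))\<^sup>2 = (S k)\<^sup>2 * (1 + (d k)\<^sup>2 / \<eta>\<^sup>2)"
    and d: "\<And>k. 1 \<le> k \<Longrightarrow> (d k)\<^sup>2 \<le> 2 * \<eta>\<^sup>2"
  shows "(\<Sum>k=1..t. (d k)\<^sup>2) \<le> 6 * \<eta>\<^sup>2 * ln (S (Suc t) / S 1)"
proof (induction t)
  case 0
  then show ?case using Spos[of 1] by simp
next
  case (Suc t)
  define k where "k = Suc t"
  have k: "1 \<le> k" by (simp add: k_def)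
  have S: "0 < S k" "0 < S (Suc k)" "0 < S 1" using Spos k by auto
  define u where "u = (d k)\<^sup>2 / \<eta>\<^sup>2"
  have u: "0 \<le> u" "u \<le> 2" using d[OF k] eta by (auto simp: u_def field_simps)
  have "u / 3 \<le> u / (1 + u)"
    using u by (intro divide_left_mono) auto
  also have "\<dots> = 1 - 1 / (1 + u)" using u by (simp add: field_simps)
  also have "\<dots> \<le> ln (1 + u)"
    using ln_one_minus_pos_lower_bound[of u] ln_le_minus_one[of "1 / (1 + u)"] u
    by (simp add: ln_div)
  also have "1 + u = (S (Suc k) / S k)\<^sup>2"
    using Srec[OF k] S by (simp add: u_def power_divide)
  also have "ln \<dots> = 2 * ln (S (Suc k) / S k)"
    using S by (simp add: ln_realpow)
  finally have "(d k)\<^sup>2 \<le> 6 * \<eta>\<^sup>2 * ln (S (Suc k) / S k)"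
    using eta by (simp add: u_def field_simps)
  moreover have "ln (S (Suc k) / S 1) = ln (S k / S 1) + ln (S (Suc k) / S k)"
    using S by (simp add: ln_div)
  ultimately show ?case
    using Suc.IH by (simp add: k_def algebra_simps)
qed

text \<open>The threshold exponent 6 is twice 3: beyond it \<open>real t ^ 3 \<le> sqrt s\<close>,
  so the root is at most a multiple of \<open>sqrt s\<close>, which the linear term dominates. Below
  it \<open>ln s \<le> 6 * ln t\<close>, whence the factor \<open>sqrt 6\<close>.\<close>

lemma sqrt_ln_absorb:
  fixes A K s :: real and t :: nat
  assumes "0 \<le> A" "0 < K" "1 \<le> s" "1 \<le> t"
  shows "A * sqrt (real t ^ 3 * ln s) - K * s \<le> A * sqrt 6 * sqrt (real t ^ 3 * ln t) + A\<^sup>2 / (2 * K)"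
proof (cases "s \<le> real t ^ 6")
  case True
  have "ln s \<le> ln (real t ^ 6)" using True assms by (intro ln_mono) auto
  also have "\<dots> = 6 * ln t" using assms by (simp add: ln_realpow)
  finally have "sqrt (real t ^ 3 * ln s) \<le> sqrt (6 * (real t ^ 3 * ln t))"
    using mult_left_mono[of "ln s" "6 * ln t" "real t ^ 3"]
    by (intro real_sqrt_le_mono) (simp add: mult.left_commute)
  also have "\<dots> = sqrt 6 * sqrt (real t ^ 3 * ln t)"
    by (rule real_sqrt_mult)
  finally have "A * sqrt (real t ^ 3 * ln s) \<le> A * sqrt 6 * sqrt (real t ^ 3 * ln t)"
    unfolding mult.assoc using assms(1) by (rule mult_left_mono)
  moreover have "0 \<le> K * s" "0 \<le> A\<^sup>2 / (2 * K)" using assms by auto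
  ultimately show ?thesis by linarith
next
  case False
  define r where "r = sqrt s"
  have r: "1 \<le> r" "s = r\<^sup>2" using assms by (auto simp: r_def)
  have "(real t ^ 3)\<^sup>2 \<le> r\<^sup>2" using False r by (simp flip: power_mult)
  then have t3: "real t ^ 3 \<le> r" by (rule power2_le_imp_le) (use r in simp)
  have "ln s = 2 * ln r" using r by (simp add: ln_realpow)
  then have "ln s \<le> 2 * r" using ln_le_minus_one[of r] r by linarith
  then have "real t ^ 3 * ln s \<le> r * (2 * r)"
    using t3 assms r by (intro mult_mono) auto
  then have "sqrt (real t ^ 3 * ln s) \<le> sqrt (2 * r\<^sup>2)"
    by (intro real_sqrt_le_mono) (simp add: power2_eq_square)
  then have "A * sqrt (real t ^ 3 * ln s) \<le> A * (sqrt 2 * r)"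
    using r assms by (intro mult_left_mono) (auto simp: real_sqrt_mult)
  \<comment> \<open>Completing the square: the right-hand side is the maximum over \<open>r\<close>
    of the left-hand side.\<close>
  moreover have "A * (sqrt 2 * r) - K * r\<^sup>2 \<le> A\<^sup>2 / (2 * K)"
  proof -
    have "0 \<le> (A - sqrt 2 * K * r)\<^sup>2" by simp
    also have "\<dots> = A\<^sup>2 - 2 * K * (A * (sqrt 2 * r) - K * r\<^sup>2)"
      by (simp add: power2_eq_square algebra_simps)
    finally show ?thesis using assms by (simp add: pos_le_divide_eq mult.commute)
  qed
  moreover have "0 \<le> A * sqrt 6 * sqrt (real t ^ 3 * ln t)" using assms by simp
  moreover have "K * s = K * r\<^sup>2" using r by simp
  ultimately show ?thesis by linarith
qed

section \<open>The convergence rate for scalar sequences\<close>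

text \<open>Stated for real sequences only, so that the constant visibly involves no dimension,
  function or iterate beyond \<open>S 1\<close> and the parameters.\<close>

lemma rate_bound:
  fixes E S R d :: "nat \<Rightarrow> real"
  assumes L: "0 \<le> L" and eta: "0 < \<eta>" and D: "D\<^sup>2 < 2 * \<eta>\<^sup>2" and Spos: "\<And>k. 1 \<le> k \<Longrightarrow> 0 < S k"
    and Srec: "\<And>k. 1 \<le> k \<Longrightarrow> (S (Suc k))\<^sup>2 = (S k)\<^sup>2 * (1 + (d k)\<^sup>2 / \<eta>\<^sup>2)"
    and R: "\<And>k. 1 \<le> k \<Longrightarrow> 0 \<le> R k \<and> R k \<le> D"
    and d: "\<And>k. 1 \<le> k \<Longrightarrow> 0 \<le> d k \<and> d k \<le> D"
    and E: "\<And>k. 1 \<le> k \<Longrightarrow> 0 \<le> E k"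
    and step: "\<And>k. 1 \<le> k \<Longrightarrow> E (Suc k) \<le> (1 - theta k) * E k
      + theta k * (theta k * S k / (2 * \<eta>)) * ((R k)\<^sup>2 - (R (Suc k))\<^sup>2 - (d k)\<^sup>2)
      + 2 * L * theta k * d k"
    and A_def: "A = 2 * L * \<eta> * sqrt 6" and K_def: "K = S 1 * (\<eta> - D\<^sup>2 / (2 * \<eta>))"
    and t: "2 \<le> t"
  shows "E (Suc t) \<le> 4 * (\<eta> * S 1 + A\<^sup>2 / (2 * K) + A * sqrt 6) * (sqrt (ln t) / sqrt t)"
proof -
  define s where "s = S (Suc t) / S 1"
  define q where "q = sqrt (real t ^ 3 * ln t)"
  have S: "0 < S 1" "0 < S (Suc t)" using Spos by auto
  have Kpos: "0 < K"
    unfolding K_def using S eta D by (simp add: field_simps power2_eq_square)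
  have A: "0 \<le> A" using L eta by (simp add: A_def)
  have d2: "(d k)\<^sup>2 \<le> 2 * \<eta>\<^sup>2" if "1 \<le> k" for k
    using power_mono[of "d k" D 2] d[OF that] D by linarith
  have ds: "(\<Sum>k=1..t. (d k)\<^sup>2) \<le> 6 * \<eta>\<^sup>2 * ln s"
    unfolding s_def using eta Spos Srec d2 by (rule sum_displacement_sq_le)
  \<comment> \<open>That \<open>S\<close> has not dropped below its initial value is read off from
    the displacement bound: a nonnegative sum forces \<open>ln s\<close> to be nonnegative.\<close>
  have "0 \<le> (\<Sum>k=1..t. (d k)\<^sup>2)" by (intro sum_nonneg) simp
  then have "0 \<le> ln s" using ds eta by (smt (verit) zero_le_mult_iff zero_less_power)
  then have s: "1 \<le> s" using S by (simp add: s_def)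
  \<comment> \<open>Cauchy-Schwarz separates the weights, whose squares sum to at most
    \<open>real t ^ 3\<close>, from the displacements, whose squares are logarithmic in
    \<open>s\<close>.\<close>
  have "(\<Sum>k=1..t. (alpha k)\<^sup>2) \<le> (\<Sum>k=1..t. (real t)\<^sup>2)"
  proof (intro sum_mono power_mono alpha_nonneg)
    show "alpha k \<le> real t" if "k \<in> {1..t}" for k
      using alpha_upper[of k] that by simp
  qed
  then have "(\<Sum>k=1..t. (alpha k)\<^sup>2) \<le> real t ^ 3"
    by (simp add: power2_eq_square power3_eq_cube)
  then have "(\<Sum>k=1..t. (alpha k)\<^sup>2) * (\<Sum>k=1..t. (d k)\<^sup>2) \<le> real t ^ 3 * (6 * \<eta>\<^sup>2 * ln s)"
    by (intro mult_mono ds) (auto intro: sum_nonneg)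
  then have "(\<Sum>k=1..t. alpha k * d k)\<^sup>2 \<le> 6 * \<eta>\<^sup>2 * (real t ^ 3 * ln s)"
    using Cauchy_Schwarz_ineq_sum[of alpha d "{1..t}"] by (simp add: mult_ac)
  then have "(\<Sum>k=1..t. alpha k * d k) \<le> sqrt (6 * \<eta>\<^sup>2 * (real t ^ 3 * ln s))"
    by (rule real_le_rsqrt)
  also have "\<dots> = sqrt 6 * \<eta> * sqrt (real t ^ 3 * ln s)"
    using eta by (simp add: real_sqrt_mult)
  finally have "2 * L * (\<Sum>k=1..t. alpha k * d k) \<le> 2 * L * (sqrt 6 * \<eta> * sqrt (real t ^ 3 * ln s))"
    using L by (intro mult_left_mono) auto
  then have cs: "2 * L * (\<Sum>k=1..t. alpha k * d k) \<le> A * sqrt (real t ^ 3 * ln s)"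
    by (simp add: A_def mult_ac)
  have "0 \<le> S (Suc t) / (2 * \<eta>) * (R (Suc t))\<^sup>2" using S eta by simp
  then have "(alpha t)\<^sup>2 * E (Suc t)
      \<le> D\<^sup>2 * S (Suc t) / (2 * \<eta>) - \<eta> * (S (Suc t) - S 1) + A * sqrt (real t ^ 3 * ln s)"
    using telescoped_bound[of \<eta> S d R D E L t, OF eta Spos Srec R step] cs by linarith
  also have "D\<^sup>2 * S (Suc t) / (2 * \<eta>) - \<eta> * (S (Suc t) - S 1) = \<eta> * S 1 - K * s"
    using S eta by (simp add: K_def s_def field_simps)
  finally have "(alpha t)\<^sup>2 * E (Suc t) \<le> \<eta> * S 1 + A\<^sup>2 / (2 * K) + A * sqrt 6 * q"
    using sqrt_ln_absorb[OF A Kpos s, of t] t by (simp add: q_def)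
  also have "\<dots> \<le> (\<eta> * S 1 + A\<^sup>2 / (2 * K)) * q + A * sqrt 6 * q"
  \<comment> \<open>Here \<open>t \<ge> 2\<close> enters: \<open>q \<ge> 1\<close> lets the constant
    terms be absorbed into multiples of \<open>q\<close>.\<close>
  proof -
    have "2 / 3 \<le> ln (real 2)" using ln2_ge_two_thirds by simp
    also have "\<dots> \<le> ln t" using t by (intro ln_mono) auto
    finally have lt: "2 / 3 \<le> ln t" .
    have "real 2 ^ 3 \<le> real t ^ 3" using t by (intro power_mono) auto
    then have "8 * (2 / 3) \<le> real t ^ 3 * ln t"
      using lt by (intro mult_mono) auto
    then have "1 \<le> q" unfolding q_def by simp
    moreover have "0 \<le> \<eta> * S 1 + A\<^sup>2 / (2 * K)" using eta S Kpos by simp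
    ultimately show ?thesis by (simp add: mult_le_cancel_left1)
  qed
  finally have ub: "(alpha t)\<^sup>2 * E (Suc t) \<le> (\<eta> * S 1 + A\<^sup>2 / (2 * K) + A * sqrt 6) * q"
    by (simp add: algebra_simps)
  \<comment> \<open>The lower bound is taken at \<open>t - 1\<close>, giving
    \<open>(t + 1) / 2\<close>; the extra 1/2 is dropped.\<close>
  have "real t / 2 \<le> alpha t"
    using alpha_Suc_lower[of "t - 1"] t by (simp add: of_nat_diff field_simps del: alpha.simps)
  then have "(real t / 2)\<^sup>2 * E (Suc t) \<le> (alpha t)\<^sup>2 * E (Suc t)"
    by (intro mult_right_mono power_mono E) auto
  with ub have "(real t / 2)\<^sup>2 * E (Suc t) \<le> (\<eta> * S 1 + A\<^sup>2 / (2 * K) + A * sqrt 6) * q"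
    by (rule order_trans[rotated])
  then have "E (Suc t) \<le> 4 * (\<eta> * S 1 + A\<^sup>2 / (2 * K) + A * sqrt 6) * (q / (real t)\<^sup>2)"
    unfolding power_divide using t by (simp add: pos_le_divide_eq mult_ac)
  moreover have "q / (real t)\<^sup>2 = sqrt (ln t) / sqrt t"
  proof -
    have "q = sqrt ((real t)\<^sup>2 * (real t * ln t))"
      by (simp add: q_def power2_eq_square power3_eq_cube mult_ac)
    also have "\<dots> = real t * (sqrt t * sqrt (ln t))"
      by (simp add: real_sqrt_mult)
    finally have "q * sqrt t = sqrt (ln t) * (real t)\<^sup>2"
      using real_sqrt_mult_self[of "real t"] by (simp add: power2_eq_square mult_ac)
    then show ?thesis using t by (simp add: frac_eq_eq)
  qed
  ultimately show ?thesis by simp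
qed

section \<open>From extended-real functions to the scalar bound\<close>

text \<open>The \<open>ereal\<close> convexity inequality has a finite right-hand side on the
  domain, so it yields convexity of the domain and of the real-valued restriction at once.\<close>

lemma convex_on_real_of_ereal:
  assumes h: "ereal_convex_on V h" and fin: "\<And>u. u \<in> V \<Longrightarrow> h u \<noteq> - \<infinity>"
  shows "convex_on (dom_on V h) (\<lambda>u. real_of_ereal (h u))"
proof -
  have V: "convex V" using h by (simp add: ereal_convex_on_def)
  have key: "u *\<^sub>R x + v *\<^sub>R y \<in> dom_on V h \<and>
      real_of_ereal (h (u *\<^sub>R x + v *\<^sub>R y)) \<le> u * real_of_ereal (h x) + v * real_of_ereal (h y)"
    if x: "x \<in> dom_on V h" and y: "y \<in> dom_on V h" and uv: "0 \<le> u" "0 \<le> v" "u + v = 1" for x y u v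
  proof -
    have xy: "x \<in> V" "y \<in> V" using x y by (auto simp: dom_on_def)
    let ?p = "u *\<^sub>R x + v *\<^sub>R y"
    have pV: "?p \<in> V" using convexD[OF V xy uv] .
    obtain a b where ab: "h x = ereal a" "h y = ereal b"
      using x y fin by (cases "h x"; cases "h y") (auto simp: dom_on_def)
    have "h ?p \<le> ereal u * h x + ereal v * h y"
      using h xy uv by (simp add: ereal_convex_on_def)
    then have le: "h ?p \<le> ereal (u * a + v * b)" by (simp add: ab)
    then show ?thesis
      using pV fin[OF pV] by (cases "h ?p") (auto simp: dom_on_def ab)
  qed
  show ?thesis
    unfolding convex_on_def convex_def using key by blast
qed

theorem corollary3:
  fixes G \<gamma> \<eta> D \<Delta> :: real
  assumes "\<gamma> > 0" and "D > 0" and "\<eta> > sqrt 2 * D / 2"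
  shows "\<exists>c>0. \<forall>(d::nat) (f :: fseq \<Rightarrow> real) (h :: fseq \<Rightarrow> ereal) (xstar :: fseq) x y z g S.
    convex_on (Rd d) f \<longrightarrow>
    G-lipschitz_on (Rd d) f \<longrightarrow>
    ereal_convex_on (Rd d) h \<longrightarrow>
    proper_on (Rd d) h \<longrightarrow>
    lsc_on (Rd d) h \<longrightarrow>
    is_arg_min (objective f h) (\<lambda>u. u \<in> Rd d) xstar \<longrightarrow>
    adaptive_apg d f h \<gamma> \<eta> x y z g S \<longrightarrow>
    y 1 = z 1 \<longrightarrow>
    z 1 \<in> dom_on (Rd d) h \<longrightarrow>
    (\<forall>k\<ge>1. norm (z (Suc k) - z k) \<le> D) \<longrightarrow>
    (\<forall>k\<ge>1. norm (z k - xstar) \<le> D) \<longrightarrow>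
    objective f h (y 1) - objective f h xstar = ereal \<Delta> \<longrightarrow>
    (\<forall>t::nat. t \<ge> 2 \<longrightarrow>
      objective f h (y (t + 1)) - objective f h xstar \<le> ereal (c * (sqrt (ln t) / sqrt t)))"
proof -
  \<comment> \<open>These are the constants of \<open>rate_bound\<close> with
    \<open>S 1 = \<gamma>\<close>, fixed before the dimension and the functions. The absolute value
    makes \<open>c\<close> positive before the Lipschitz assumption supplies
    \<open>0 \<le> G\<close>.\<close>
  define A where "A = 2 * \<bar>G\<bar> * \<eta> * sqrt 6"
  define K where "K = \<gamma> * (\<eta> - D\<^sup>2 / (2 * \<eta>))"
  define c where "c = 4 * (\<eta> * \<gamma> + A\<^sup>2 / (2 * K) + A * sqrt 6)"
  have eta: "0 < \<eta>" using assms by (smt (verit) divide_nonneg_nonneg mult_nonneg_nonneg real_sqrt_ge_zero)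
  have "(sqrt 2 * D / 2)\<^sup>2 < \<eta>\<^sup>2"
    using assms by (intro power_strict_mono) auto
  then have D2: "D\<^sup>2 < 2 * \<eta>\<^sup>2" by (simp add: power_divide power_mult_distrib)
  have "0 < K"
    unfolding K_def using assms(1) eta D2 by (simp add: field_simps power2_eq_square)
  then have c: "0 < c"
    unfolding c_def A_def using assms(1) eta
    by (intro mult_pos_pos add_pos_nonneg divide_nonneg_nonneg mult_nonneg_nonneg) auto
  show ?thesis
  proof (intro exI[of _ c] conjI c allI impI)
    fix d :: nat and f :: "fseq \<Rightarrow> real" and h :: "fseq \<Rightarrow> ereal" and xstar :: fseq
      and x y z g :: "nat \<Rightarrow> fseq" and S :: "nat \<Rightarrow> real" and t :: nat
    assume f: "G-lipschitz_on (Rd d) f" and hconv: "ereal_convex_on (Rd d) h"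
      and hproper: "proper_on (Rd d) h"
      and xs: "is_arg_min (objective f h) (\<lambda>u. u \<in> Rd d) xstar"
      and apg: "adaptive_apg d f h \<gamma> \<eta> x y z g S"
      and y1: "y 1 = z 1" and z1: "z 1 \<in> dom_on (Rd d) h"
      and dz: "\<forall>k\<ge>1. norm (z (Suc k) - z k) \<le> D"
      and Rz: "\<forall>k\<ge>1. norm (z k - xstar) \<le> D"
      and t: "2 \<le> t"
    define C where "C = dom_on (Rd d) h"
    define H where "H u = real_of_ereal (h u)" for u
    have fin: "\<And>u. u \<in> Rd d \<Longrightarrow> h u \<noteq> - \<infinity>" using hproper by (simp add: proper_on_def)
    have H: "convex_on C H"
      unfolding C_def H_def using convex_on_real_of_ereal[OF hconv fin] .
    have hH: "h u = ereal (H u)" if "u \<in> C" for u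
      using that fin[of u] unfolding H_def C_def dom_on_def by (cases "h u") auto
    have CV: "C \<subseteq> Rd d" by (auto simp: C_def dom_on_def)
    have z1C: "z 1 \<in> C" using z1 by (simp add: C_def)
    \<comment> \<open>Serves both \<open>xstar\<close> (with \<open>q = f\<close>) and every prox
      step: comparison with a point of finite value puts the minimiser in \<open>C\<close>, where
      minimality becomes a real inequality.\<close>
    have min_C: "p \<in> C" "q p + H p \<le> q u + H u"
      if p: "is_arg_min (\<lambda>u. ereal (q u) + h u) (\<lambda>u. u \<in> Rd d) p" and u: "u \<in> C" for q p u
    proof -
      have pV: "p \<in> Rd d" using p by (simp add: is_arg_min_def)
      have le: "ereal (q p) + h p \<le> ereal (q u) + h u"
        using p u CV by (auto simp: is_arg_min_def not_less)
      show pC: "p \<in> C"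
        using le pV unfolding hH[OF u] C_def dom_on_def by (cases "h p") auto
      show "q p + H p \<le> q u + H u" using le by (simp add: hH u pC)
    qed
    have xs': "is_arg_min (\<lambda>u. ereal (f u) + h u) (\<lambda>u. u \<in> Rd d) xstar"
      using xs by (simp add: objective_def[abs_def])
    have xsC: "xstar \<in> C" using min_C(1)[OF xs' z1C] .
    note iter = apg[unfolded adaptive_apg_def]
    have S1: "S 1 = \<gamma>" using iter by blast
    have x_eq: "x k = (1 - theta k) *\<^sub>R y k + theta k *\<^sub>R z k"
      and gk: "g k \<in> subdifferential (Rd d) f (x k)"
      and zmin: "is_arg_min
          (\<lambda>u. ereal (inner (g k) u + theta k * S k / (2 * \<eta>) * (norm (u - z k))\<^sup>2) + h u)
          (\<lambda>u. u \<in> Rd d) (z (Suc k))"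
      and y_eq: "y (Suc k) = x k + theta k *\<^sub>R (z (Suc k) - z k)"
      and S_eq: "(S (Suc k))\<^sup>2 = (S k)\<^sup>2 * (1 + (norm (z (Suc k) - z k))\<^sup>2 / \<eta>\<^sup>2)"
      and S_pos: "S (Suc k) > 0"
      if "1 \<le> k" for k
      using iter that by blast+
    have Spos: "0 < S k" if "1 \<le> k" for k
      using that S1 assms(1) S_pos[of "k - 1"] by (cases "k = 1") auto
    \<comment> \<open>From index 2 on, \<open>z k\<close> is a prox minimiser and is compared with
      \<open>z 1\<close>; index 1 is the starting assumption.\<close>
    have zC: "z k \<in> C" if "1 \<le> k" for k
      using that
    proof (cases "k = 1")
      case False
      then have "1 \<le> k - 1" "Suc (k - 1) = k" using that by auto
      then show ?thesis using min_C(1)[OF zmin z1C, of "k - 1"] by simp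
    qed (use z1C in simp)
    have th: "0 < theta k" "theta k \<le> 1" if "1 \<le> k" for k
    proof -
      have "1 \<le> alpha k"
        using that alpha_Suc_lower[of "k - 1"] by (simp add: of_nat_diff field_simps del: alpha.simps)
      then show "0 < theta k" "theta k \<le> 1" by (auto simp: theta_def)
    qed
    have yC: "y k \<in> C" if "1 \<le> k" for k
      using that
    proof (induction k rule: nat_induct_at_least)
      case base
      then show ?case using y1 z1C by simp
    next
      case (Suc k)
      show ?case
        using apg_step(1)[OF subspace_Rd f H CV th[OF Suc.hyps] Suc.IH zC[OF Suc.hyps] zC xsC
            x_eq[OF Suc.hyps] gk[OF Suc.hyps] min_C(2)[OF zmin[OF Suc.hyps]] y_eq[OF Suc.hyps]]
        by simp
    qed
    define E where "E k = f (y k) + H (y k) - (f xstar + H xstar)" for k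
    \<comment> \<open>All iterates and \<open>xstar\<close> lie in \<open>C\<close>, so the gaps
      \<open>E\<close> are real, and \<open>apg_step\<close> with \<open>w = xstar\<close> and
      \<open>a = theta k * S k / (2 * \<eta>)\<close> supplies the recursion.\<close>
    have "E (Suc t) \<le> 4 * (\<eta> * S 1 + A\<^sup>2 / (2 * K) + A * sqrt 6) * (sqrt (ln t) / sqrt t)"
    proof (rule rate_bound[where L = G and d = "\<lambda>k. norm (z (Suc k) - z k)"
            and R = "\<lambda>k. norm (z k - xstar)" and D = D, OF _ eta D2 Spos S_eq _ _ _ _ _ _ t])
      show G: "0 \<le> G" using lipschitz_on_nonneg[OF f] .
      show "A = 2 * G * \<eta> * sqrt 6" using G by (simp add: A_def)
      show "K = S 1 * (\<eta> - D\<^sup>2 / (2 * \<eta>))" by (simp only: K_def S1)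
      fix k :: nat
      assume k: "1 \<le> k"
      show "0 \<le> norm (z k - xstar) \<and> norm (z k - xstar) \<le> D" using Rz k by simp
      show "0 \<le> norm (z (Suc k) - z k) \<and> norm (z (Suc k) - z k) \<le> D" using dz k by simp
      show "0 \<le> E k" using min_C(2)[OF xs' yC[OF k]] by (simp add: E_def)
      show "E (Suc k) \<le> (1 - theta k) * E k + theta k * (theta k * S k / (2 * \<eta>)) *
          ((norm (z k - xstar))\<^sup>2 - (norm (z (Suc k) - xstar))\<^sup>2 - (norm (z (Suc k) - z k))\<^sup>2)
          + 2 * G * theta k * norm (z (Suc k) - z k)"
        unfolding E_def
        by (rule apg_step(2)[OF subspace_Rd f H CV th[OF k] yC[OF k] zC[OF k] zC xsC
            x_eq[OF k] gk[OF k] min_C(2)[OF zmin[OF k]] y_eq[OF k]]) auto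
    qed
    then have "E (Suc t) \<le> c * (sqrt (ln t) / sqrt t)" by (simp only: c_def S1)
    then show "objective f h (y (t + 1)) - objective f h xstar \<le> ereal (c * (sqrt (ln t) / sqrt t))"
      by (simp add: objective_def hH yC xsC E_def)
  qed
qed

end
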